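(* Let $X$ be a sequentially Hausdorff sequential space. Then $\mathcal{K}_{\mathrm{uV}}(X)$ is a continuous retract of $\mathcal{O\!O}_{+}(X)$: the map $e\colon\mathcal{K}_{\mathrm{uV}}(X)\to\mathcal{O\!O}_{+}(X)$, $e(K)=\{U\in\mathcal{O}(X)\mid K\subseteq U\}$, is well defined and continuous, the map $H\mapsto\bigcap(H)$ is a well-defined continuous map $\mathcal{O\!O}_{+}(X)\to\mathcal{K}_{\mathrm{uV}}(X)$, and $\bigcap(e(K))=K$ for all $K\in\mathcal{K}_{\mathrm{uV}}(X)$.
   Context: A sequential space is one in which every sequentially open set is open; it is sequentially Hausdorff if every convergent sequence has a unique limit. The sequentialisation of a topology is the family of its sequentially open sets. $\mathcal{O}(X)$ is the set of open subsets of $X$ with the $\omega$-Scott topology: $H\subseteq\mathcal{O}(X)$ is open iff $H$ is upward closed under inclusion and meets every countable directed family $\mathcal{D}\subseteq\mathcal{O}(X)$ with $\bigcup\mathcal{D}\in H$; this is a sequential space, and $\mathcal{O}(\mathcal{O}(X))$ denotes the set of $\omega$-Scott open subsets of $\mathcal{O}(X)$ with the analogous $\omega$-Scott topology. $\mathcal{O\!O}_{+}(X)$ is the subspace of $\mathcal{O}(\mathcal{O}(X))$ consisting of the non-empty $\omega$-Scott open collections of opens. $\mathcal{K}_{\mathrm{uV}}(X)$ is the set of countably compact subsets of $X$ (every countable open cover has a finite subcover) with the sequentialisation of the upper Vietoris topology, generated by the sets $\Box U=\{K\mid K\subseteq U\}$, $U$ open. *)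

theory Defs
  imports "HOL-Analysis.Analysis"
begin

definition seq_openin :: "'a topology \<Rightarrow> 'a set \<Rightarrow> bool" where
  "seq_openin X U \<longleftrightarrow> U \<subseteq> topspace X \<and>
     (\<forall>x l. range x \<subseteq> topspace X \<and> limitin X x l sequentially \<and> l \<in> U
        \<longrightarrow> (\<forall>\<^sub>F n in sequentially. x n \<in> U))"

definition sequential_space :: "'a topology \<Rightarrow> bool" where
  "sequential_space X \<longleftrightarrow> (\<forall>U. seq_openin X U \<longrightarrow> openin X U)"

definition sequentially_Hausdorff :: "'a topology \<Rightarrow> bool" where
  "sequentially_Hausdorff X \<longleftrightarrow>
     (\<forall>x l l'. range x \<subseteq> topspace X \<and> limitin X x l sequentially \<and> limitin X x l' sequentially
        \<longrightarrow> l = l')"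

definition sequentialisation :: "'a topology \<Rightarrow> 'a topology" where
  "sequentialisation X = topology (seq_openin X)"

lemma istopology_seq_openin: "istopology (seq_openin X)"
  unfolding istopology_def
proof (intro conjI allI impI)
  fix S T assume S: "seq_openin X S" and T: "seq_openin X T"
  then show "seq_openin X (S \<inter> T)"
    unfolding seq_openin_def by (simp add: eventually_conj_iff) blast
next
  fix \<K> assume \<K>: "\<forall>K\<in>\<K>. seq_openin X K"
  show "seq_openin X (\<Union>\<K>)"
    unfolding seq_openin_def
  proof (intro conjI allI impI)
    show "\<Union>\<K> \<subseteq> topspace X"
      using \<K> unfolding seq_openin_def by blast
  next
    fix x l
    assume *: "range x \<subseteq> topspace X \<and> limitin X x l sequentially \<and> l \<in> \<Union>\<K>"
    then obtain K where K: "K \<in> \<K>" "l \<in> K" by blast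
    then have "\<forall>\<^sub>F n in sequentially. x n \<in> K"
      using * \<K> unfolding seq_openin_def by blast
    then show "\<forall>\<^sub>F n in sequentially. x n \<in> \<Union>\<K>"
      by (rule eventually_mono) (use K in blast)
  qed
qed

lemma openin_sequentialisation [simp]: "openin (sequentialisation X) = seq_openin X"
  unfolding sequentialisation_def using istopology_seq_openin by (rule topology_inverse')

lemma topspace_sequentialisation [simp]: "topspace (sequentialisation X) = topspace X"
proof -
  have "seq_openin X (topspace X)"
    unfolding seq_openin_def by (auto simp: limitin_def)
  moreover have "seq_openin X U \<Longrightarrow> U \<subseteq> topspace X" for U
    unfolding seq_openin_def by simp
  ultimately show ?thesis
    unfolding topspace_def[of "sequentialisation X"] by auto
qed

definition directed_family :: "'a set set \<Rightarrow> bool" where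
  "directed_family \<D> \<longleftrightarrow> \<D> \<noteq> {} \<and> (\<forall>A\<in>\<D>. \<forall>B\<in>\<D>. \<exists>C\<in>\<D>. A \<subseteq> C \<and> B \<subseteq> C)"

definition omega_Scott_open :: "'a topology \<Rightarrow> 'a set set \<Rightarrow> bool" where
  "omega_Scott_open X H \<longleftrightarrow> H \<subseteq> {U. openin X U} \<and>
     (\<forall>U V. U \<in> H \<and> openin X V \<and> U \<subseteq> V \<longrightarrow> V \<in> H) \<and>
     (\<forall>\<D>. countable \<D> \<and> \<D> \<subseteq> {U. openin X U} \<and> directed_family \<D> \<and> \<Union>\<D> \<in> H
        \<longrightarrow> \<D> \<inter> H \<noteq> {})"

definition opens_space :: "'a topology \<Rightarrow> 'a set topology" where
  "opens_space X = topology (omega_Scott_open X)"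

lemma istopology_omega_Scott_open: "istopology (omega_Scott_open X)"
  unfolding istopology_def
proof (intro conjI allI impI)
  fix S T assume S: "omega_Scott_open X S" and T: "omega_Scott_open X T"
  show "omega_Scott_open X (S \<inter> T)"
    unfolding omega_Scott_open_def
  proof (intro conjI allI impI)
    show "S \<inter> T \<subseteq> {U. openin X U}"
      using S unfolding omega_Scott_open_def by blast
  next
    fix U V assume "U \<in> S \<inter> T \<and> openin X V \<and> U \<subseteq> V"
    then show "V \<in> S \<inter> T"
      using S T unfolding omega_Scott_open_def by blast
  next
    fix \<D> assume D: "countable \<D> \<and> \<D> \<subseteq> {U. openin X U} \<and> directed_family \<D> \<and> \<Union>\<D> \<in> S \<inter> T"
    have "\<D> \<inter> S \<noteq> {}" using S D unfolding omega_Scott_open_def by blast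
    moreover have "\<D> \<inter> T \<noteq> {}" using T D unfolding omega_Scott_open_def by blast
    ultimately obtain A B where AB: "A \<in> \<D>" "A \<in> S" "B \<in> \<D>" "B \<in> T" by blast
    then obtain C where C: "C \<in> \<D>" "A \<subseteq> C" "B \<subseteq> C"
      using D unfolding directed_family_def by blast
    then have "openin X C" using D by blast
    then have "C \<in> S \<inter> T"
      using S T AB C unfolding omega_Scott_open_def by blast
    then show "\<D> \<inter> (S \<inter> T) \<noteq> {}" using C by blast
  qed
next
  fix \<K> assume \<K>: "\<forall>K\<in>\<K>. omega_Scott_open X K"
  show "omega_Scott_open X (\<Union>\<K>)"
    unfolding omega_Scott_open_def
  proof (intro conjI allI impI)
    show "\<Union>\<K> \<subseteq> {U. openin X U}"
      using \<K> unfolding omega_Scott_open_def by blast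
  next
    fix U V assume *: "U \<in> \<Union>\<K> \<and> openin X V \<and> U \<subseteq> V"
    then obtain K where "K \<in> \<K>" "U \<in> K" by blast
    then show "V \<in> \<Union>\<K>"
      using * \<K> unfolding omega_Scott_open_def by blast
  next
    fix \<D> assume *: "countable \<D> \<and> \<D> \<subseteq> {U. openin X U} \<and> directed_family \<D> \<and> \<Union>\<D> \<in> \<Union>\<K>"
    then obtain K where K: "K \<in> \<K>" "\<Union>\<D> \<in> K" by blast
    then have "\<D> \<inter> K \<noteq> {}"
      using * \<K> unfolding omega_Scott_open_def by blast
    then show "\<D> \<inter> \<Union>\<K> \<noteq> {}" using K by blast
  qed
qed

lemma openin_opens_space [simp]: "openin (opens_space X) = omega_Scott_open X"
  unfolding opens_space_def using istopology_omega_Scott_open by (rule topology_inverse')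

lemma topspace_opens_space [simp]: "topspace (opens_space X) = {U. openin X U}"
proof -
  have "omega_Scott_open X {U. openin X U}"
    unfolding omega_Scott_open_def directed_family_def by (auto simp: Int_absorb2)
  moreover have "omega_Scott_open X H \<Longrightarrow> H \<subseteq> {U. openin X U}" for H
    unfolding omega_Scott_open_def by simp
  ultimately show ?thesis
    unfolding topspace_def[of "opens_space X"] by auto
qed

text \<open>The non-empty collections form an open subset of the space of opens of opens, so the subspace
  topology is already sequential and needs no further sequentialisation.\<close>

definition OO_plus :: "'a topology \<Rightarrow> 'a set set topology" where
  "OO_plus X = subtopology (opens_space (opens_space X)) {H. H \<noteq> {}}"

lemma topspace_OO_plus: "topspace (OO_plus X) = {H. omega_Scott_open X H \<and> H \<noteq> {}}"
  unfolding OO_plus_def by auto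

definition countably_compactin :: "'a topology \<Rightarrow> 'a set \<Rightarrow> bool" where
  "countably_compactin X K \<longleftrightarrow> K \<subseteq> topspace X \<and>
     (\<forall>\<U>. countable \<U> \<and> (\<forall>U\<in>\<U>. openin X U) \<and> K \<subseteq> \<Union>\<U>
        \<longrightarrow> (\<exists>\<F>. finite \<F> \<and> \<F> \<subseteq> \<U> \<and> K \<subseteq> \<Union>\<F>))"

text \<open>The generating set for \<open>U = topspace X\<close> contains every countably compact subset of \<open>X\<close>, so the
  carrier is exactly the set of countably compact subsets, including the empty one.\<close>

definition upper_Vietoris :: "'a topology \<Rightarrow> 'a set topology" where
  "upper_Vietoris X =
     topology_generated_by {{K. countably_compactin X K \<and> K \<subseteq> U} | U. openin X U}"

definition K_uV :: "'a topology \<Rightarrow> 'a set topology" where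
  "K_uV X = sequentialisation (upper_Vietoris X)"

lemma topspace_K_uV: "topspace (K_uV X) = {K. countably_compactin X K}"
proof -
  have "K \<in> \<Union>{{K. countably_compactin X K \<and> K \<subseteq> U} | U. openin X U}"
    if "countably_compactin X K" for K
    using that openin_topspace[of X] unfolding countably_compactin_def by blast
  then show ?thesis
    unfolding K_uV_def upper_Vietoris_def by auto
qed

definition open_nbhds :: "'a topology \<Rightarrow> 'a set \<Rightarrow> 'a set set" where
  "open_nbhds X K = {U. openin X U \<and> K \<subseteq> U}"

end

theory Submission
  imports Defs
begin

text \<open>The substance is that, for an increasing sequence \<open>H\<^sub>n\<close> of \<open>\<omega>\<close>-Scott open collections and an
  increasing sequence of opens \<open>U\<^sub>n\<close> covering \<open>\<Inter>(\<Union>\<^sub>n H\<^sub>n)\<close>, some \<open>U\<^sub>n\<close> contains \<open>\<Inter>H\<^sub>n\<close>. Otherwise choose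
  \<open>x\<^sub>n \<in> \<Inter>H\<^sub>n - U\<^sub>n\<close>. If no subsequence converges, the tails of \<open>x\<close> are closed; if some subsequence
  converges to \<open>l\<close>, then \<open>l \<notin> \<Inter>(\<Union>\<^sub>n H\<^sub>n)\<close> and the tails of that subsequence become closed after adding \<open>l\<close>.
  Either way the complements of these sets increase to a set belonging to some \<open>H\<^sub>m\<close>, so one of these
  complements lies in \<open>H\<^sub>m\<close> and therefore contains \<open>x\<^sub>k\<close> for all \<open>k \<ge> m\<close>, which is absurd.

  A constant sequence \<open>H\<^sub>n\<close> gives countable compactness of \<open>\<Inter>H\<close>, and a constant sequence \<open>U\<^sub>n\<close> gives
  the convergence of \<open>\<Inter>H\<^sub>n\<close> to \<open>\<Inter>(\<Union>\<^sub>n H\<^sub>n)\<close>, hence continuity of \<open>H \<mapsto> \<Inter>H\<close>. Continuity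
  of \<open>e\<close> holds because a sequence converging in the upper Vietoris topology, together with its limit,
  has countably compact union.\<close>

section \<open>Directed families\<close>

lemma directed_family_finite_bound:
  assumes "directed_family \<D>" "finite \<F>" "\<F> \<subseteq> \<D>"
  shows "\<exists>C\<in>\<D>. \<Union>\<F> \<subseteq> C"
  using assms(2,3)
proof (induction rule: finite_induct)
  case empty
  then show ?case using assms(1) by (auto simp: directed_family_def)
next
  case (insert A \<F>)
  then obtain C where "C \<in> \<D>" "\<Union>\<F> \<subseteq> C" by auto
  moreover obtain B where "B \<in> \<D>" "A \<subseteq> B" "C \<subseteq> B"
    using assms(1) insert.prems \<open>C \<in> \<D>\<close> unfolding directed_family_def by (meson insert_subset)
  ultimately show ?case by auto
qed

lemma directed_family_increasing_range:
  assumes "\<And>n. g n \<subseteq> g (Suc n)"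
  shows "directed_family (range g)"
proof -
  have "incseq g" using assms by (rule incseq_SucI)
  then have "g m \<subseteq> g (max m n) \<and> g n \<subseteq> g (max m n)" for m n
    by (simp add: incseqD)
  then show ?thesis unfolding directed_family_def by blast
qed

text \<open>Recursion along an enumeration of \<open>\<D>\<close>: each term bounds its predecessor
  and the next enumerated member. Tests against countable directed families thus reduce to
  increasing sequences.\<close>

lemma countable_directed_family_cofinal:
  assumes "countable \<D>" "directed_family \<D>"
  obtains g where "\<And>n::nat. g n \<in> \<D>" "incseq g" "\<Union>\<D> = (\<Union>n. g n)"
proof -
  have ne: "\<D> \<noteq> {}" using assms(2) by (simp add: directed_family_def)
  have ex: "\<exists>y. (y \<in> \<D> \<and> from_nat_into \<D> (Suc n) \<subseteq> y) \<and> x \<subseteq> y" if "x \<in> \<D>" for x n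
    using assms(2) that from_nat_into[OF ne, of "Suc n"] unfolding directed_family_def by blast
  have "\<exists>g. \<forall>n. (g n \<in> \<D> \<and> from_nat_into \<D> n \<subseteq> g n) \<and> g n \<subseteq> g (Suc n)"
    by (rule dependent_nat_choice) (use ex from_nat_into[OF ne, of 0] in blast)+
  then obtain g where g: "\<And>n. g n \<in> \<D>" "\<And>n. from_nat_into \<D> n \<subseteq> g n" "\<And>n. g n \<subseteq> g (Suc n)"
    by blast
  have "\<Union>\<D> = (\<Union>n. from_nat_into \<D> n)"
    using range_from_nat_into[OF ne assms(1)] by simp
  then have "\<Union>\<D> = (\<Union>n. g n)" using g(1,2) by blast
  then show ?thesis using that g(1) incseq_SucI[of g] g(3) by blast
qed

lemma countably_compactin_finite_subcover:
  assumes "countably_compactin X K" "countable \<U>" "\<And>U. U \<in> \<U> \<Longrightarrow> openin X U" "K \<subseteq> \<Union>\<U>"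
  obtains \<F> where "finite \<F>" "\<F> \<subseteq> \<U>" "K \<subseteq> \<Union>\<F>"
proof -
  have "\<exists>\<F>. finite \<F> \<and> \<F> \<subseteq> \<U> \<and> K \<subseteq> \<Union>\<F>"
    using assms(1)[unfolded countably_compactin_def, THEN conjunct2, rule_format, of \<U>] assms(2-4) by simp
  then show ?thesis using that by blast
qed

text \<open>Directedness merges the finite subcover into a single member; this is what makes
  \<open>open_nbhds X K\<close> omega-Scott open.\<close>

lemma countably_compactin_directed:
  assumes "countably_compactin X K" "countable \<D>" "\<D> \<subseteq> {U. openin X U}"
    "directed_family \<D>" "K \<subseteq> \<Union>\<D>"
  shows "\<exists>C\<in>\<D>. K \<subseteq> C"
proof -
  obtain \<F> where "finite \<F>" "\<F> \<subseteq> \<D>" "K \<subseteq> \<Union>\<F>"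
    using countably_compactin_finite_subcover[OF assms(1,2)] assms(3,5) by (metis mem_Collect_eq subsetD)
  then show ?thesis using directed_family_finite_bound[OF assms(4), of \<F>] by (meson order_trans)
qed

lemma omega_Scott_open_mono:
  "omega_Scott_open X H \<Longrightarrow> U \<in> H \<Longrightarrow> openin X V \<Longrightarrow> U \<subseteq> V \<Longrightarrow> V \<in> H"
  unfolding omega_Scott_open_def by blast

lemma omega_Scott_open_openin: "omega_Scott_open X H \<Longrightarrow> U \<in> H \<Longrightarrow> openin X U"
  unfolding omega_Scott_open_def by blast

lemma omega_Scott_open_increasing:
  fixes V :: "nat \<Rightarrow> 'a set"
  assumes "omega_Scott_open X H" "\<And>n. openin X (V n)" "incseq V" "(\<Union>n. V n) \<in> H"
  shows "\<exists>n. V n \<in> H"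
proof -
  have "directed_family (range V)"
    by (rule directed_family_increasing_range) (use assms(3) in \<open>simp add: incseq_SucD\<close>)
  moreover have "range V \<subseteq> {U. openin X U}" using assms(2) by blast
  ultimately have "range V \<inter> H \<noteq> {}"
    using assms(1)[unfolded omega_Scott_open_def, THEN conjunct2, THEN conjunct2, rule_format, of "range V"]
      assms(4) by simp
  then show ?thesis by blast
qed

section \<open>Convergent sequences and closed sets\<close>

text \<open>Subsequences are taken along any \<open>f\<close> tending to infinity, monotone or not,
  so indices read off from a sequence in the range of \<open>x\<close> need no thinning out.\<close>

lemma limitin_filterlim_subsequence:
  assumes "limitin X x l sequentially" "filterlim f at_top sequentially"
  shows "limitin X (\<lambda>n. x (f n)) l sequentially"
proof -
  have "\<forall>\<^sub>F n in sequentially. x (f n) \<in> U" if "\<forall>\<^sub>F n in sequentially. x n \<in> U" for U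
    using that assms(2) by (rule eventually_compose_filterlim)
  then show ?thesis using assms(1) by (simp add: limitin_def)
qed

lemma sequentially_Hausdorff_unique:
  assumes "sequentially_Hausdorff X" "\<And>n. x n \<in> topspace X"
    "limitin X x l sequentially" "limitin X x l' sequentially"
  shows "l = l'"
  using assms unfolding sequentially_Hausdorff_def by blast

lemma frequently_sequentially_subsequence:
  assumes "\<exists>\<^sub>F n in sequentially. P n"
  shows "\<exists>r::nat \<Rightarrow> nat. filterlim r at_top sequentially \<and> (\<forall>n. P (r n))"
proof -
  have "infinite {n. P n}"
    using assms by (simp add: frequently_cofinite cofinite_eq_sequentially[symmetric])
  then obtain r :: "nat \<Rightarrow> nat" where "strict_mono r" "\<And>n. r n \<in> {n. P n}"
    using infinite_enumerate by blast
  then show ?thesis using filterlim_subseq by blast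
qed

lemma range_offset:
  fixes n :: nat
  shows "range (\<lambda>k. y (k + n)) = y ` {n..}"
proof -
  have "i \<in> range (\<lambda>k. k + n)" if "n \<le> i" for i
    using that by (intro range_eqI[of _ _ "i - n"]) simp
  then have "{n..} = range (\<lambda>k. k + n)" by auto
  then show ?thesis by (simp add: image_image)
qed

text \<open>A sequence converging to a point outside \<open>A\<close> but meeting \<open>A\<close>
  infinitely often has a subsequence inside \<open>A\<close>, whose limit would have to lie in
  \<open>A\<close>.\<close>

lemma sequential_space_open_complement:
  assumes "sequential_space X"
    and closed: "\<And>s z. \<lbrakk>range s \<subseteq> topspace X; range s \<subseteq> A; limitin X s z sequentially\<rbrakk> \<Longrightarrow> z \<in> A"
  shows "openin X (topspace X - A)"
proof -
  have "seq_openin X (topspace X - A)"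
    unfolding seq_openin_def
  proof (intro conjI allI impI)
    fix s z
    assume s: "range s \<subseteq> topspace X \<and> limitin X s z sequentially \<and> z \<in> topspace X - A"
    show "\<forall>\<^sub>F n in sequentially. s n \<in> topspace X - A"
    proof (rule ccontr)
      assume "\<not> ?thesis"
      then have "\<exists>\<^sub>F n in sequentially. s n \<in> A"
        by (rule contrapos_np) (use s in \<open>auto simp: frequently_def image_subset_iff\<close>)
      then have "\<exists>r::nat \<Rightarrow> nat. filterlim r at_top sequentially \<and> (\<forall>n. s (r n) \<in> A)"
        by (rule frequently_sequentially_subsequence)
      then obtain r :: "nat \<Rightarrow> nat"
        where r: "filterlim r at_top sequentially \<and> (\<forall>n. s (r n) \<in> A)" ..
      have "limitin X (\<lambda>n. s (r n)) z sequentially"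
        by (rule limitin_filterlim_subsequence) (use s r in simp_all)
      moreover have "range (\<lambda>n. s (r n)) \<subseteq> topspace X"
        using s by auto
      moreover have "range (\<lambda>n. s (r n)) \<subseteq> A" using r by (simp add: image_subset_iff)
      ultimately have "z \<in> A" using closed by blast
      then show False using s by blast
    qed
  qed auto
  then show ?thesis using assms(1) unfolding sequential_space_def by blast
qed

text \<open>If \<open>f\<close> does not tend to infinity, it takes some value infinitely often, and \<open>z\<close> is the
  limit of the corresponding constant subsequence.\<close>

lemma limit_in_range_or_diverging_index:
  fixes x :: "nat \<Rightarrow> 'a"
  assumes "sequentially_Hausdorff X" "\<And>n. x n \<in> topspace X"
    "limitin X (\<lambda>n. x (f n)) z sequentially"
  shows "z \<in> range x \<or> filterlim f at_top sequentially"
proof (rule disjCI)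
  assume "\<not> filterlim f at_top sequentially"
  then obtain N where "\<not> (\<forall>\<^sub>F n in sequentially. N \<le> f n)"
    unfolding filterlim_at_top by blast
  then have "\<exists>\<^sub>F n in sequentially. f n < N" by (simp add: frequently_def not_less)
  then have "\<exists>\<^sub>F n in sequentially. \<exists>i\<in>{..<N}. f n = i" by simp
  then obtain i where "\<exists>\<^sub>F n in sequentially. f n = i"
    unfolding frequently_bex_finite_distrib[OF finite_lessThan] by blast
  then obtain r where r: "filterlim r at_top sequentially" "\<And>n. f (r n) = i"
    using frequently_sequentially_subsequence[of "\<lambda>n. f n = i"] by blast
  have "limitin X (\<lambda>n. x i) z sequentially"
    using limitin_filterlim_subsequence[OF assms(3) r(1)] r(2) by simp
  moreover have "limitin X (\<lambda>n. x i) (x i) sequentially"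
    using assms(2) by (simp add: limitin_def)
  ultimately have "z = x i"
    using sequentially_Hausdorff_unique[OF assms(1), of "\<lambda>n. x i"] assms(2) by blast
  then show "z \<in> range x" by blast
qed

text \<open>A convergent sequence in the range is \<open>x\<close> reindexed by some
  \<open>f\<close>. Either its limit is already a term of \<open>x\<close>, or \<open>f\<close>
  tends to infinity and the last hypothesis applies.\<close>

lemma openin_complement_range:
  fixes x :: "nat \<Rightarrow> 'a"
  assumes "sequential_space X" "sequentially_Hausdorff X" "\<And>n. x n \<in> topspace X"
    and "\<And>f z. \<lbrakk>filterlim f at_top sequentially; limitin X (\<lambda>n. x (f n)) z sequentially\<rbrakk>
          \<Longrightarrow> z \<in> range x"
  shows "openin X (topspace X - range x)"
proof (rule sequential_space_open_complement[OF assms(1)])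
  fix s z
  assume s: "range s \<subseteq> range x" "limitin X s z sequentially"
  then have "\<forall>n. \<exists>i. s n = x i" by blast
  then obtain f where "\<And>n. s n = x (f n)" by metis
  then have "s = (\<lambda>n. x (f n))" by auto
  then show "z \<in> range x"
    using limit_in_range_or_diverging_index[of X x f z] assms(2-4) s(2) by blast
qed

text \<open>Once the limit counts as a term, uniqueness of limits puts the limit of every reindexing
  that tends to infinity back into the range.\<close>

lemma openin_complement_convergent_sequence:
  assumes "sequential_space X" "sequentially_Hausdorff X" "\<And>n. x n \<in> topspace X"
    "limitin X x l sequentially"
  shows "openin X (topspace X - insert l (range x))"
proof -
  \<comment> \<open>Prepending \<open>l\<close> makes \<open>insert l (range x)\<close> the range of
    one sequence; the shift by one leaves the limit unchanged.\<close>
  define y where "y = case_nat l x"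
  have lim: "limitin X y l sequentially"
  proof -
    have "limitin X (\<lambda>n. y (n + 1)) l sequentially"
      using assms(4) by (simp add: y_def)
    then show ?thesis by (rule limitin_sequentially_offset_rev)
  qed
  have top: "y n \<in> topspace X" for n
    using assms(3,4) limitin_topspace[of X x l] by (auto simp: y_def split: nat.split)
  have range: "range y = insert l (range x)"
    by (auto simp: y_def image_iff split: nat.splits)
  have "openin X (topspace X - range y)"
  proof (rule openin_complement_range[OF assms(1,2)])
    fix f z assume "filterlim f at_top sequentially" "limitin X (\<lambda>n. y (f n)) z sequentially"
    then have "z = l"
      using limitin_filterlim_subsequence[OF lim] top
        sequentially_Hausdorff_unique[OF assms(2), of "\<lambda>n. y (f n)"] by blast
    then show "z \<in> range y" using range by blast
  qed (use top in blast)
  then show ?thesis using range by simp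
qed

lemma openin_complement_point:
  assumes "sequential_space X" "sequentially_Hausdorff X" "a \<in> topspace X"
  shows "openin X (topspace X - {a})"
  using openin_complement_convergent_sequence[OF assms(1,2), of "\<lambda>n. a" a] assms(3)
  by (simp add: limitin_def)

section \<open>Intersections of omega-Scott open collections\<close>

text \<open>The contradiction shared by both cases of the main argument: \<open>L\<close> is empty
  when no subsequence converges and is \<open>{l}\<close> when one converges to \<open>l\<close>.
  Adjoining \<open>L\<close> closes the tails, and \<open>W\<close> forces the complement of
  \<open>L\<close> into \<open>H m\<close>.\<close>

lemma omega_Scott_open_avoids_no_tails:
  assumes H: "\<And>n. omega_Scott_open X (H n)" "incseq H"
    and y: "\<And>k. y k \<in> \<Inter>(H (f k))" "filterlim f at_top sequentially"
    and open_compl: "\<And>n. openin X (topspace X - (L \<union> y ` {n..}))"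
    and tails: "\<And>a. \<not> (\<exists>\<^sub>F k in sequentially. y k = a)"
    and W: "W \<in> H m" "W \<inter> L = {}" "L \<subseteq> topspace X"
    and L: "openin X (topspace X - L)"
  shows False
proof -
  define V where "V n = topspace X - (L \<union> y ` {n..})" for n
  have "incseq V" unfolding V_def by (rule incseq_SucI) auto
  have "(\<Union>n. V n) = topspace X - L"
  proof -
    \<comment> \<open>No value recurs infinitely often, so each point drops out of some
      tail.\<close>
    have "\<exists>n. a \<notin> y ` {n..}" for a
    proof -
      have "\<forall>\<^sub>F k in sequentially. y k \<noteq> a" using tails[of a] by (simp add: frequently_def)
      then show ?thesis unfolding eventually_sequentially by blast
    qed
    then have "a \<in> (\<Union>n. V n)" if "a \<in> topspace X - L" for a
      using that by (simp add: V_def)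
    then show ?thesis by (auto simp: V_def)
  qed
  moreover have "topspace X - L \<in> H m"
    using omega_Scott_open_mono[OF H(1) W(1) L] W(2) omega_Scott_open_openin[OF H(1) W(1)]
      openin_subset by blast
  ultimately have "\<exists>n. V n \<in> H m"
    using omega_Scott_open_increasing[OF H(1), of V m] open_compl \<open>incseq V\<close> by (simp add: V_def)
  then obtain n where n: "V n \<in> H m" by blast
  \<comment> \<open>The index must be large twice over: \<open>m \<le> f k\<close> puts
    \<open>V n\<close> into \<open>H (f k)\<close>, hence \<open>y k\<close> into
    \<open>V n\<close>, while \<open>n \<le> k\<close> places \<open>y k\<close> in the deleted
    tail.\<close>
  have "\<forall>\<^sub>F k in sequentially. m \<le> f k \<and> n \<le> k"
    using y(2) by (simp add: filterlim_at_top eventually_conj_iff eventually_ge_at_top)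
  then obtain k where k: "m \<le> f k" "n \<le> k" using eventually_happens' by force
  then have "V n \<in> H (f k)" using n H(2) by (auto dest: incseqD)
  then have "y k \<in> V n" using y(1) by blast
  then show False using k(2) by (simp add: V_def)
qed

lemma Inter_omega_Scott_open_covered:
  fixes H :: "nat \<Rightarrow> 'a set set" and U :: "nat \<Rightarrow> 'a set"
  assumes X: "sequential_space X" "sequentially_Hausdorff X"
    and H: "\<And>n. omega_Scott_open X (H n)" "incseq H" "\<And>n. H n \<noteq> {}"
    and U: "\<And>n. openin X (U n)" "incseq U"
    and cover: "\<Inter>(\<Union>n. H n) \<subseteq> (\<Union>n. U n)"
  shows "\<exists>n. \<Inter>(H n) \<subseteq> U n"
proof (rule ccontr)
  assume "\<not> ?thesis"
  then have "\<forall>n. \<exists>a. a \<in> \<Inter>(H n) - U n" by blast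
  then obtain x where x: "\<And>n. x n \<in> \<Inter>(H n)" "\<And>n. x n \<notin> U n" by (metis DiffD1 DiffD2)
  have top: "topspace X \<in> H n" for n
    using H(1,3) omega_Scott_open_mono omega_Scott_open_openin openin_subset openin_topspace
    by (metis all_not_in_conv)
  have x_top: "x n \<in> topspace X" for n using x(1) top by blast
  \<comment> \<open>As \<open>U\<close> increases, \<open>U m\<close> is contained in
    \<open>U (f k)\<close> once \<open>m \<le> f k\<close>, and \<open>x (f k)\<close> avoids the
    latter.\<close>
  have not_in_U: "\<forall>\<^sub>F k in sequentially. x (f k) \<notin> U m"
    if "filterlim f at_top sequentially" for f :: "nat \<Rightarrow> nat" and m
  proof -
    have "\<forall>\<^sub>F k in sequentially. m \<le> f k" using that by (simp add: filterlim_at_top)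
    then show ?thesis by eventually_elim (use x(2) U(2) in \<open>blast dest: incseqD\<close>)
  qed
  \<comment> \<open>A recurring value would lie in every member of every \<open>H m\<close>, because
    \<open>H m\<close> is contained in the later collections. The cover would then put it in some
    \<open>U m\<close>, which the sequence eventually leaves.\<close>
  have not_constant: "\<not> (\<exists>\<^sub>F k in sequentially. x (f k) = a)"
    if f: "filterlim f at_top sequentially" for f a
  proof
    assume freq: "\<exists>\<^sub>F k in sequentially. x (f k) = a"
    have all: "a \<in> A" if "A \<in> H m" for m A
    proof -
      have "\<forall>\<^sub>F k in sequentially. m \<le> f k" using f by (simp add: filterlim_at_top)
      then have "\<exists>\<^sub>F k in sequentially. x (f k) = a \<and> m \<le> f k"
        using frequently_eventually_frequently[OF freq] by blast
      then obtain k where "x (f k) = a" "m \<le> f k" using frequently_ex by blast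
      moreover have "A \<in> H (f k)" using incseqD[OF H(2) \<open>m \<le> f k\<close>] that by blast
      ultimately show ?thesis using x(1)[of "f k"] by blast
    qed
    have "a \<in> \<Inter>(\<Union>n. H n)" using all by auto
    then have "a \<in> (\<Union>n. U n)" using cover by (rule subsetD[rotated])
    then obtain m where "a \<in> U m" by blast
    moreover have "\<exists>\<^sub>F k in sequentially. x (f k) = a \<and> x (f k) \<notin> U m"
      using freq not_in_U[OF f] by (rule frequently_eventually_frequently)
    ultimately show False using frequently_ex by blast
  qed
  show False
  proof (cases "\<exists>f l. filterlim f at_top sequentially \<and> limitin X (\<lambda>k. x (f k)) l sequentially")
    case True
    then obtain f l where f: "filterlim f at_top sequentially"
      and l: "limitin X (\<lambda>k. x (f k)) l sequentially" by blast
    have l_top: "l \<in> topspace X" using l by (rule limitin_topspace)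
    have "l \<notin> U m" for m
    proof
      assume "l \<in> U m"
      then have "\<forall>\<^sub>F k in sequentially. x (f k) \<in> U m" using l U(1) by (simp add: limitin_def)
      with not_in_U[OF f, of m] have "\<forall>\<^sub>F k::nat in sequentially. False"
        by eventually_elim blast
      then show False by simp
    qed
    \<comment> \<open>Since \<open>l\<close> lies in no \<open>U m\<close>, the cover excludes it
      from the intersection, so some member of some collection omits it.\<close>
    then obtain W m where W: "W \<in> H m" "l \<notin> W" using cover by blast
    have opn: "openin X (topspace X - ({l} \<union> (\<lambda>k. x (f k)) ` {n..}))" for n
    proof -
      have "limitin X (\<lambda>k. x (f (k + n))) l sequentially"
        using l by (rule limitin_sequentially_offset)
      moreover have "range (\<lambda>k. x (f (k + n))) = (\<lambda>k. x (f k)) ` {n..}"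
        by (rule range_offset)
      ultimately show ?thesis
        using openin_complement_convergent_sequence[OF X, of "\<lambda>k. x (f (k + n))" l] x_top
        by simp
    qed
    show False
      by (rule omega_Scott_open_avoids_no_tails[OF H(1,2), of "\<lambda>k. x (f k)" f "{l}" W m])
        (use x(1) f opn not_constant W l_top openin_complement_point[OF X] in auto)
  next
    case False
    \<comment> \<open>A reindexing of a tail is a reindexing of \<open>x\<close> itself, and none
      that tends to infinity converges, so the last hypothesis of
      \<open>openin_complement_range\<close> holds vacuously.\<close>
    have opn: "openin X (topspace X - ({} \<union> x ` {n..}))" for n
    proof -
      have "openin X (topspace X - range (\<lambda>k. x (k + n)))"
      proof (rule openin_complement_range[OF X])
        fix f z assume "filterlim f at_top sequentially"
          "limitin X (\<lambda>k. x (f k + n)) z sequentially"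
        moreover from this(1) have "filterlim (\<lambda>k. f k + n) at_top sequentially"
          by (rule filterlim_at_top_mono) simp
        ultimately show "z \<in> range (\<lambda>k. x (k + n))" using False by blast
      qed (use x_top in blast)
      moreover have "range (\<lambda>k. x (k + n)) = x ` {n..}"
        by (rule range_offset)
      ultimately show ?thesis by simp
    qed
    \<comment> \<open>With \<open>L\<close> empty, the whole space serves as \<open>W\<close>; it
      belongs to every \<open>H n\<close>.\<close>
    show False
      by (rule omega_Scott_open_avoids_no_tails[OF H(1,2), of x "\<lambda>k. k" "{}" "topspace X" 0])
        (use x(1) opn not_constant[of "\<lambda>k. k"] top in \<open>auto simp: filterlim_ident\<close>)
  qed
qed

lemma countably_compactin_Inter:
  assumes X: "sequential_space X" "sequentially_Hausdorff X"
    and H: "omega_Scott_open X H" "H \<noteq> {}"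
  shows "countably_compactin X (\<Inter>H)"
  unfolding countably_compactin_def
proof (intro conjI allI impI)
  show "\<Inter>H \<subseteq> topspace X"
    using H omega_Scott_open_openin openin_subset by blast
next
  fix \<U> assume \<U>: "countable \<U> \<and> (\<forall>U\<in>\<U>. openin X U) \<and> \<Inter>H \<subseteq> \<Union>\<U>"
  show "\<exists>\<F>. finite \<F> \<and> \<F> \<subseteq> \<U> \<and> \<Inter>H \<subseteq> \<Union>\<F>"
  \<comment> \<open>The empty cover is treated apart because \<open>from_nat_into\<close> enumerates
    only non-empty sets.\<close>
  proof (cases "\<U> = {}")
    case True
    then show ?thesis using \<U> by auto
  next
    case False
    \<comment> \<open>Partial unions turn the cover into an increasing sequence; containment in one
      of them is a finite subcover.\<close>
    define U where "U n = \<Union>(from_nat_into \<U> ` {..n})" for n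
    have "(\<Union>n. U n) = \<Union>(range (from_nat_into \<U>))" unfolding U_def by blast
    also have "range (from_nat_into \<U>) = \<U>"
      using False \<U> by simp
    finally have "(\<Union>n. U n) = \<Union>\<U>" .
    moreover have "openin X (U n)" for n
      unfolding U_def using \<U> from_nat_into[OF False] by blast
    moreover have "incseq U"
      unfolding U_def incseq_def by (auto intro: order_trans)
    ultimately obtain n where "\<Inter>H \<subseteq> U n"
      using Inter_omega_Scott_open_covered[OF X, of "\<lambda>n. H" U] H \<U> by (auto simp: incseq_def)
    then have "finite (from_nat_into \<U> ` {..n}) \<and> from_nat_into \<U> ` {..n} \<subseteq> \<U>
        \<and> \<Inter>H \<subseteq> \<Union>(from_nat_into \<U> ` {..n})"
      unfolding U_def using from_nat_into[OF False] by auto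
    then show ?thesis by blast
  qed
qed

section \<open>Convergence in the upper Vietoris topology\<close>

lemma topspace_upper_Vietoris: "topspace (upper_Vietoris X) = {K. countably_compactin X K}"
  using topspace_K_uV[of X] by (simp add: K_uV_def)

text \<open>Convergence need only be tested on the generating sets, since the sets passing the test
  are stable under finite intersections and arbitrary unions.\<close>

lemma limitin_upper_Vietoris:
  "limitin (upper_Vietoris X) x K sequentially \<longleftrightarrow> countably_compactin X K \<and>
     (\<forall>U. openin X U \<and> K \<subseteq> U \<longrightarrow> (\<forall>\<^sub>F n in sequentially. countably_compactin X (x n) \<and> x n \<subseteq> U))"
  (is "?lim \<longleftrightarrow> ?rhs")
proof
  assume lim: ?lim
  show ?rhs
  proof (intro conjI allI impI)
    show K: "countably_compactin X K"
      using limitin_topspace[OF lim] by (simp add: topspace_upper_Vietoris)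
    fix U assume U: "openin X U \<and> K \<subseteq> U"
    have "openin (upper_Vietoris X) {K. countably_compactin X K \<and> K \<subseteq> U}"
      unfolding upper_Vietoris_def by (rule topology_generated_by_Basis) (use U in blast)
    then show "\<forall>\<^sub>F n in sequentially. countably_compactin X (x n) \<and> x n \<subseteq> U"
      using lim K U by (auto simp: limitin_def elim!: allE[of _ "{K. countably_compactin X K \<and> K \<subseteq> U}"])
  qed
next
  assume rhs: ?rhs
  have "K \<in> W \<Longrightarrow> \<forall>\<^sub>F n in sequentially. x n \<in> W" if "openin (upper_Vietoris X) W" for W
    using that unfolding upper_Vietoris_def openin_topology_generated_by_iff
  proof (induction rule: generate_topology_on.induct)
    case (Int A B)
    then show ?case by (simp add: eventually_conj_iff)
  next
    case (UN \<K>)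
    then obtain A where A: "A \<in> \<K>" "K \<in> A" by blast
    then have "\<forall>\<^sub>F n in sequentially. x n \<in> A" using UN by blast
    then show ?case by (rule eventually_mono) (use A in blast)
  next
    case (Basis S)
    then show ?case using rhs by auto
  qed simp
  then show ?lim using rhs by (simp add: limitin_def topspace_upper_Vietoris)
qed

text \<open>The constant sequence \<open>L\<close> converges to \<open>K\<close>, since every open
  set containing \<open>K\<close> contains \<open>L\<close>. This later gives upward closure of
  preimages under intersection.\<close>

lemma seq_openin_upper_Vietoris_antimono:
  assumes "seq_openin (upper_Vietoris X) W" "K \<in> W" "countably_compactin X L" "L \<subseteq> K"
  shows "L \<in> W"
proof -
  have "countably_compactin X K"
    using assms(1,2) by (auto simp: seq_openin_def topspace_upper_Vietoris)
  then have "limitin (upper_Vietoris X) (\<lambda>n. L) K sequentially"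
    using assms(3,4) by (auto simp: limitin_upper_Vietoris)
  moreover have "range (\<lambda>n::nat. L) \<subseteq> topspace (upper_Vietoris X)"
    using assms(3) by (simp add: topspace_upper_Vietoris)
  ultimately have "\<forall>\<^sub>F n::nat in sequentially. L \<in> W"
    using assms(1,2) unfolding seq_openin_def by blast
  then show ?thesis by simp
qed

text \<open>A finite subfamily covering \<open>K\<close> also covers \<open>x i\<close> for all
  \<open>i \<ge> m\<close>, by convergence; the finitely many remaining terms each add a finite
  subcover.\<close>

lemma countably_compactin_convergent_sequence_Un:
  assumes lim: "limitin (upper_Vietoris X) x K sequentially"
    and x: "\<And>n. countably_compactin X (x n)"
  shows "countably_compactin X (K \<union> (\<Union>i\<in>{n..}. x i))"
  unfolding countably_compactin_def
proof (intro conjI allI impI)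
  have K: "countably_compactin X K" using lim by (simp add: limitin_upper_Vietoris)
  show "K \<union> (\<Union>i\<in>{n..}. x i) \<subseteq> topspace X"
    using K x unfolding countably_compactin_def by blast
  fix \<U> assume \<U>: "countable \<U> \<and> (\<forall>U\<in>\<U>. openin X U) \<and> K \<union> (\<Union>i\<in>{n..}. x i) \<subseteq> \<Union>\<U>"
  then have "K \<subseteq> \<Union>\<U>" by blast
  then obtain \<F> where \<F>: "finite \<F>" "\<F> \<subseteq> \<U>" "K \<subseteq> \<Union>\<F>"
    using countably_compactin_finite_subcover[OF K, of \<U>] \<U> by metis
  have "openin X (\<Union>\<F>)" using \<F>(2) \<U> by blast
  then have "\<forall>\<^sub>F i in sequentially. countably_compactin X (x i) \<and> x i \<subseteq> \<Union>\<F>"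
    using lim \<F>(3) unfolding limitin_upper_Vietoris by blast
  then obtain m where m: "\<And>i. i \<ge> m \<Longrightarrow> x i \<subseteq> \<Union>\<F>"
    unfolding eventually_sequentially by blast
  have "\<exists>\<G>. finite \<G> \<and> \<G> \<subseteq> \<U> \<and> x i \<subseteq> \<Union>\<G>" if "i \<ge> n" for i
  proof -
    have "x i \<subseteq> \<Union>\<U>" using \<U> that by blast
    then show ?thesis using countably_compactin_finite_subcover[OF x[of i], of \<U>] \<U> by metis
  qed
  then obtain \<G> where \<G>: "\<And>i. i \<ge> n \<Longrightarrow> finite (\<G> i) \<and> \<G> i \<subseteq> \<U> \<and> x i \<subseteq> \<Union>(\<G> i)"
    by metis
  have "x i \<subseteq> \<Union>(\<F> \<union> \<Union>(\<G> ` {n..<m}))" if "i \<ge> n" for i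
  proof (cases "i \<ge> m")
    case True
    then show ?thesis using m by blast
  next
    case False
    then have "i \<in> {n..<m}" using that by simp
    then show ?thesis using \<G>[OF that] by blast
  qed
  then have "(\<Union>i\<in>{n..}. x i) \<subseteq> \<Union>(\<F> \<union> \<Union>(\<G> ` {n..<m}))" by (intro UN_least) simp
  then have "K \<union> (\<Union>i\<in>{n..}. x i) \<subseteq> \<Union>(\<F> \<union> \<Union>(\<G> ` {n..<m}))"
    using \<F>(3) by auto
  moreover have "finite (\<F> \<union> \<Union>(\<G> ` {n..<m}))" using \<F>(1) \<G> by auto
  moreover have "\<F> \<union> \<Union>(\<G> ` {n..<m}) \<subseteq> \<U>"
    using \<F>(2) \<G> by (intro Un_least UN_least) simp_all
  ultimately show "\<exists>\<F>. finite \<F> \<and> \<F> \<subseteq> \<U> \<and> K \<union> (\<Union>i\<in>{n..}. x i) \<subseteq> \<Union>\<F>" by blast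
qed

section \<open>The retraction\<close>

lemma omega_Scott_open_open_nbhds:
  assumes "countably_compactin X K"
  shows "omega_Scott_open X (open_nbhds X K)"
  unfolding omega_Scott_open_def
proof (intro conjI allI impI)
  fix \<D> assume "countable \<D> \<and> \<D> \<subseteq> {U. openin X U} \<and> directed_family \<D> \<and> \<Union>\<D> \<in> open_nbhds X K"
  moreover from this obtain C where "C \<in> \<D>" "K \<subseteq> C"
    using countably_compactin_directed[OF assms, of \<D>] by (auto simp: open_nbhds_def)
  ultimately show "\<D> \<inter> open_nbhds X K \<noteq> {}" unfolding open_nbhds_def by blast
qed (auto simp: open_nbhds_def)

lemma open_nbhds_in_OO_plus:
  assumes "countably_compactin X K"
  shows "open_nbhds X K \<in> topspace (OO_plus X)"
proof -
  have "topspace X \<in> open_nbhds X K"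
    using assms by (simp add: open_nbhds_def countably_compactin_def)
  then show ?thesis
    using omega_Scott_open_open_nbhds[OF assms] by (auto simp: topspace_OO_plus)
qed

text \<open>Points are closed, so the complement of a point outside \<open>K\<close> is an open
  neighbourhood of \<open>K\<close> omitting it.\<close>

lemma Inter_open_nbhds:
  assumes "sequential_space X" "sequentially_Hausdorff X" "countably_compactin X K"
  shows "\<Inter>(open_nbhds X K) = K"
proof
  have K: "K \<subseteq> topspace X" using assms(3) by (simp add: countably_compactin_def)
  show "\<Inter>(open_nbhds X K) \<subseteq> K"
  proof
    fix a assume a: "a \<in> \<Inter>(open_nbhds X K)"
    then have "a \<in> topspace X" using K by (auto simp: open_nbhds_def)
    show "a \<in> K"
    proof (rule ccontr)
      assume "a \<notin> K"
      then have "topspace X - {a} \<in> open_nbhds X K"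
        using openin_complement_point[OF assms(1,2) \<open>a \<in> topspace X\<close>] K
        by (auto simp: open_nbhds_def)
      then show False using a by blast
    qed
  qed
qed (auto simp: open_nbhds_def)

lemma continuous_map_open_nbhds: "continuous_map (K_uV X) (OO_plus X) (open_nbhds X)"
proof -
  have "openin (K_uV X) {K \<in> topspace (K_uV X). open_nbhds X K \<in> \<H>}"
    if \<H>: "omega_Scott_open (opens_space X) \<H>" for \<H>
    unfolding K_uV_def openin_sequentialisation seq_openin_def
  proof (intro conjI allI impI)
    fix x K
    assume x: "range x \<subseteq> topspace (upper_Vietoris X) \<and> limitin (upper_Vietoris X) x K sequentially
      \<and> K \<in> {K \<in> topspace (sequentialisation (upper_Vietoris X)). open_nbhds X K \<in> \<H>}"
    then have cc: "countably_compactin X (x n)" for n by (auto simp: topspace_upper_Vietoris)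
    \<comment> \<open>Convergence says exactly that the \<open>G n\<close> increase to
      \<open>open_nbhds X K\<close>, so some \<open>G n\<close> lies in \<open>\<H>\<close>. It is
      contained in \<open>open_nbhds X (x i)\<close> for every \<open>i \<ge> n\<close>, and
      \<open>\<H>\<close> is upward closed.\<close>
    define G where "G n = open_nbhds X (K \<union> (\<Union>i\<in>{n..}. x i))" for n
    have "open_nbhds X K \<subseteq> (\<Union>n. G n)"
    proof
      fix U assume U: "U \<in> open_nbhds X K"
      then have "\<forall>\<^sub>F i in sequentially. countably_compactin X (x i) \<and> x i \<subseteq> U"
        using x by (simp add: limitin_upper_Vietoris open_nbhds_def)
      then obtain n where "\<And>i. i \<ge> n \<Longrightarrow> x i \<subseteq> U" unfolding eventually_sequentially by blast
      then have "U \<in> G n" using U by (auto simp: G_def open_nbhds_def)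
      then show "U \<in> (\<Union>n. G n)" by blast
    qed
    moreover have "(\<Union>n. G n) \<subseteq> open_nbhds X K" by (auto simp: G_def open_nbhds_def)
    ultimately have "(\<Union>n. G n) = open_nbhds X K" by blast
    then have "(\<Union>n. G n) \<in> \<H>" using x by simp
    moreover have "openin (opens_space X) (G n)" for n
      unfolding G_def openin_opens_space
      using x cc by (intro omega_Scott_open_open_nbhds countably_compactin_convergent_sequence_Un) auto
    moreover have "incseq G"
      unfolding G_def by (rule incseq_SucI) (force simp: open_nbhds_def)
    ultimately obtain n where n: "G n \<in> \<H>"
      using omega_Scott_open_increasing[OF \<H>, of G] by blast
    have "x i \<in> {K \<in> topspace (sequentialisation (upper_Vietoris X)). open_nbhds X K \<in> \<H>}"
      if "i \<ge> n" for i
    proof -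
      have "G n \<subseteq> open_nbhds X (x i)" using that by (auto simp: G_def open_nbhds_def)
      then have "open_nbhds X (x i) \<in> \<H>"
        using omega_Scott_open_mono[OF \<H> n] omega_Scott_open_open_nbhds[OF cc[of i]] by simp
      then show ?thesis using cc by (simp add: topspace_upper_Vietoris)
    qed
    then show "\<forall>\<^sub>F n in sequentially.
        x n \<in> {K \<in> topspace (sequentialisation (upper_Vietoris X)). open_nbhds X K \<in> \<H>}"
      unfolding eventually_sequentially by blast
  qed auto
  then have "continuous_map (K_uV X) (opens_space (opens_space X)) (open_nbhds X)"
    by (auto simp: continuous_map_def topspace_K_uV omega_Scott_open_open_nbhds)
  moreover have "open_nbhds X \<in> topspace (K_uV X) \<rightarrow> {H. H \<noteq> {}}"
    using open_nbhds_in_OO_plus by (auto simp: topspace_K_uV topspace_OO_plus)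
  ultimately show ?thesis unfolding OO_plus_def by (simp add: continuous_map_in_subtopology image_subset_iff_funcset)
qed

lemma limitin_Inter_omega_Scott_open:
  assumes X: "sequential_space X" "sequentially_Hausdorff X"
    and H: "\<And>n. omega_Scott_open X (H n)" "incseq H" "\<And>n. H n \<noteq> {}"
  shows "limitin (upper_Vietoris X) (\<lambda>n. \<Inter>(H n)) (\<Inter>(\<Union>n. H n)) sequentially"
  unfolding limitin_upper_Vietoris
proof (intro conjI allI impI)
  \<comment> \<open>The union is again omega-Scott open, so the candidate limit is countably
    compact.\<close>
  have "openin (opens_space X) (\<Union>n. H n)" by (rule openin_Union) (use H(1) in auto)
  then show "countably_compactin X (\<Inter>(\<Union>n. H n))"
    using H(3) by (intro countably_compactin_Inter[OF X]) auto
  fix U assume "openin X U \<and> \<Inter>(\<Union>n. H n) \<subseteq> U"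
  then obtain n where n: "\<Inter>(H n) \<subseteq> U"
    using Inter_omega_Scott_open_covered[OF X H, of "\<lambda>n. U"] by (auto simp: incseq_def)
  have "countably_compactin X (\<Inter>(H i)) \<and> \<Inter>(H i) \<subseteq> U" if "i \<ge> n" for i
  proof -
    have "\<Inter>(H i) \<subseteq> \<Inter>(H n)" using H(2) that by (intro Inter_anti_mono) (rule incseqD)
    then show ?thesis using n countably_compactin_Inter[OF X H(1,3)] by blast
  qed
  then show "\<forall>\<^sub>F n in sequentially. countably_compactin X (\<Inter>(H n)) \<and> \<Inter>(H n) \<subseteq> U"
    unfolding eventually_sequentially by blast
qed

lemma continuous_map_Inter:
  assumes X: "sequential_space X" "sequentially_Hausdorff X"
  shows "continuous_map (OO_plus X) (K_uV X) (\<lambda>H. \<Inter>H)"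
  unfolding continuous_map_def
proof (intro conjI allI impI)
  show "(\<lambda>H. \<Inter>H) \<in> topspace (OO_plus X) \<rightarrow> topspace (K_uV X)"
    using countably_compactin_Inter[OF X] by (auto simp: topspace_OO_plus topspace_K_uV)
  fix W assume "openin (K_uV X) W"
  then have W: "seq_openin (upper_Vietoris X) W" by (simp add: K_uV_def)
  define P where "P = {H \<in> topspace (OO_plus X). \<Inter>H \<in> W}"
  \<comment> \<open>Openness is proved in the full space of opens of opens; it passes to the
    subspace because \<open>P\<close> has only non-empty members.\<close>
  have "omega_Scott_open (opens_space X) P"
    unfolding omega_Scott_open_def[of "opens_space X"] openin_opens_space
  proof (intro conjI allI impI)
    show "P \<subseteq> {H. omega_Scott_open X H}" by (auto simp: P_def topspace_OO_plus)
  next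
    fix H H' assume *: "H \<in> P \<and> omega_Scott_open X H' \<and> H \<subseteq> H'"
    then have "H' \<noteq> {}" "\<Inter>H \<in> W" by (auto simp: P_def topspace_OO_plus)
    moreover from this have "\<Inter>H' \<in> W"
      using seq_openin_upper_Vietoris_antimono[OF W] countably_compactin_Inter[OF X, of H'] *
      by (meson Inter_anti_mono)
    ultimately show "H' \<in> P" using * by (simp add: P_def topspace_OO_plus)
  next
    fix \<D> assume \<D>: "countable \<D> \<and> \<D> \<subseteq> {H. omega_Scott_open X H} \<and> directed_family \<D> \<and> \<Union>\<D> \<in> P"
    then obtain g where g: "\<And>n::nat. g n \<in> \<D>" "incseq g" "\<Union>\<D> = (\<Union>n. g n)"
      using countable_directed_family_cofinal[of \<D>] by metis
    have "(\<Union>n. g n) \<noteq> {}" "\<Inter>(\<Union>n. g n) \<in> W"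
      using \<D> g(3) by (auto simp: P_def topspace_OO_plus)
    \<comment> \<open>Early terms of \<open>g\<close> may be empty, and \<open>\<Inter>{}\<close> is
      \<open>UNIV\<close>, which need not be countably compact. Dropping the first \<open>m\<close>
      terms leaves only non-empty collections and the same union.\<close>
    then obtain m where m: "g m \<noteq> {}" by blast
    define h where "h n = g (m + n)" for n
    have h: "omega_Scott_open X (h n)" "h n \<noteq> {}" for n
      using g(1)[of "m + n"] \<D> m incseqD[OF g(2), of m "m + n"] by (auto simp: h_def)
    have inc: "incseq h" using g(2) by (simp add: h_def incseq_def)
    have "(\<Union>n. h n) = (\<Union>n. g n)"
      unfolding h_def using incseqD[OF g(2), of _ "m + _"] by (blast intro: le_add2)
    then have "limitin (upper_Vietoris X) (\<lambda>n. \<Inter>(h n)) (\<Inter>(\<Union>n. g n)) sequentially"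
      using limitin_Inter_omega_Scott_open[OF X h(1) inc h(2)] by simp
    moreover have "range (\<lambda>n. \<Inter>(h n)) \<subseteq> topspace (upper_Vietoris X)"
      using countably_compactin_Inter[OF X h] by (auto simp: topspace_upper_Vietoris)
    ultimately have "\<forall>\<^sub>F n in sequentially. \<Inter>(h n) \<in> W"
      using W \<open>\<Inter>(\<Union>n. g n) \<in> W\<close> unfolding seq_openin_def by blast
    then obtain n where "\<Inter>(h n) \<in> W" using eventually_happens' by force
    then have "h n \<in> P" using h by (simp add: P_def topspace_OO_plus)
    then show "\<D> \<inter> P \<noteq> {}" using g(1) by (auto simp: h_def)
  qed
  moreover have "P = P \<inter> {H. H \<noteq> {}}" by (auto simp: P_def topspace_OO_plus)
  ultimately show "openin (OO_plus X) {H \<in> topspace (OO_plus X). \<Inter>H \<in> W}"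
    unfolding P_def[symmetric] unfolding OO_plus_def openin_subtopology by auto
qed

theorem theorem3p1:
  fixes X :: "'a topology"
  assumes "sequential_space X" and "sequentially_Hausdorff X"
  shows "retraction_maps (OO_plus X) (K_uV X) (\<lambda>H. \<Inter>H) (open_nbhds X) \<and>
         (\<forall>K \<in> topspace (K_uV X). open_nbhds X K \<in> topspace (OO_plus X)) \<and>
         continuous_map (K_uV X) (OO_plus X) (open_nbhds X) \<and>
         (\<forall>H \<in> topspace (OO_plus X). \<Inter>H \<in> topspace (K_uV X)) \<and>
         continuous_map (OO_plus X) (K_uV X) (\<lambda>H. \<Inter>H) \<and>
         (\<forall>K \<in> topspace (K_uV X). \<Inter>(open_nbhds X K) = K)"
  using continuous_map_open_nbhds[of X] continuous_map_Inter[OF assms]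
    open_nbhds_in_OO_plus[of X] countably_compactin_Inter[OF assms] Inter_open_nbhds[OF assms]
  unfolding retraction_maps_def by (auto simp: topspace_OO_plus topspace_K_uV)

end
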